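(* Let $\alpha_0,\lambda_0\in\mathbb R$ and let $u\in\mathcal S(\mathbb R)$ satisfy $\|u\|_{L^2(\mathbb R)}=1$, $u(x)=0$ if and only if $x=\lambda_0$, and $1+\alpha_0\gamma(|u|^2,\lambda_0)=0$. For $\alpha\in\mathbb R$ let $H_\alpha=M_x+\alpha\langle\cdot,u\rangle u$ on $L^2(\mathbb R)$. For any fixed $h\in\mathbb R$, $$\lim_{\alpha\to\alpha_0}R^{(\alpha)}(\lambda_h(\alpha))=-\frac{2i}{h+i}\qquad\text{and}\qquad \lim_{\alpha\to\alpha_0}|R^{(\alpha)}(\lambda_h(\alpha))|^2=\frac{4}{h^2+1}.$$
   Context: The inner product is linear in its first argument. $M_x$ is the self-adjoint operator of multiplication by $x$ on $L^2(\mathbb R)$, with maximal domain; $H_\alpha$ has the same domain, and $H_0=M_x$. For $f\in\mathcal S(\mathbb R)$, $\lambda\in\mathbb R$, $\gamma(f,\lambda)=\lim_{\epsilon\to0^+}\int_{|x-\lambda|\ge\epsilon}\frac{f(x)}{x-\lambda}\,dx$ (Cauchy principal value). Put $F_1(\alpha,\lambda)=1+\alpha\gamma(|u|^2,\lambda)$, $F_2(\alpha,\lambda)=\alpha\pi|u(\lambda)|^2$, $F=F_1+iF_2$. For $\alpha\ne\alpha_0$, $F(\alpha,\cdot)$ never vanishes. The function $\phi$ is defined by $\phi(x)=u(x)/(x-\lambda_0)$ for $x\ne\lambda_0$ and $\phi(\lambda_0)=u'(\lambda_0)$; it is an eigenvector of $H_{\alpha_0}$ for the simple eigenvalue $\lambda_0$.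 Let $J$ be an open interval around $\alpha_0$ and $\lambda:J\to\mathbb R$, $\alpha\mapsto\lambda(\alpha)$, a $C^1$ function with $\lambda(\alpha_0)=\lambda_0$ and $F_1(\alpha,\lambda(\alpha))=0$ for $\alpha\in J$ (these exist by the implicit function theorem). For $\alpha\in J$, $h\in\mathbb R$ set $\kappa(\alpha)=\pi|u(\lambda(\alpha))|^2/\|\phi\|^2$ and $\lambda_h(\alpha)=\lambda(\alpha)+h\kappa(\alpha)$. For $\alpha\ne\alpha_0$ the wave operators $\Omega^{(\alpha)}_\pm=\mathrm{s\text{-}lim}_{t\to\pm\infty}e^{itH_\alpha}e^{-itH_0}$ exist and are complete, and the scattering operator $S^{(\alpha)}=\Omega_+^{(\alpha)*}\Omega_-^{(\alpha)}$ is multiplication by the function (known stationary formula, which fixes the representative used at every point) $S^{(\alpha)}(x)=1-2\pi i\alpha\frac{|u(x)|^2}{F(\alpha,x)}=\frac{\overline{F(\alpha,x)}}{F(\alpha,x)}$, $x\in\mathbb R$. Put $R^{(\alpha)}(x)=S^{(\alpha)}(x)-1$. Limits $\alpha\to\alpha_0$ are over $\alpha\neq\alpha_0$. *)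

theory Defs
  imports "HOL-Analysis.Analysis"
begin

section \<open>Schwartz functions and the principal value integral\<close>

definition schwartz :: "(real \<Rightarrow> complex) \<Rightarrow> bool" where
  "schwartz f \<longleftrightarrow>
     (let D = (\<lambda>n. ((\<lambda>g x. vector_derivative g (at x)) ^^ n) f)
      in (\<forall>n x. D n differentiable (at x)) \<and>
         (\<forall>k n. bounded (range (\<lambda>x. x ^ k *\<^sub>R D n x))))"

definition pv :: "(real \<Rightarrow> 'a::{banach, second_countable_topology}) \<Rightarrow> real \<Rightarrow> 'a" where
  "pv f l = Lim (at_right 0) (\<lambda>\<epsilon>. LINT x:{x. \<bar>x - l\<bar> \<ge> \<epsilon>}|lborel. f x /\<^sub>R (x - l))"


section \<open>The Hilbert space of square integrable functions\<close>

text \<open>Elements are represented by square integrable Borel functions, and equality in the Hilbert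
  space is equality almost everywhere.\<close>

definition l2 :: "(real \<Rightarrow> complex) set" where
  "l2 = {f. f \<in> borel_measurable lborel \<and> integrable lborel (\<lambda>x. (cmod (f x))\<^sup>2)}"

definition l2_inner :: "(real \<Rightarrow> complex) \<Rightarrow> (real \<Rightarrow> complex) \<Rightarrow> complex" where
  "l2_inner f g = (LINT x|lborel. f x * cnj (g x))"

definition l2_norm :: "(real \<Rightarrow> complex) \<Rightarrow> real" where
  "l2_norm f = sqrt (LINT x|lborel. (cmod (f x))\<^sup>2)"

definition l2_tendsto ::
  "('t \<Rightarrow> real \<Rightarrow> complex) \<Rightarrow> (real \<Rightarrow> complex) \<Rightarrow> 't filter \<Rightarrow> bool" where
  "l2_tendsto f g Fl \<longleftrightarrow> ((\<lambda>t. l2_norm (\<lambda>x. f t x - g x)) \<longlongrightarrow> 0) Fl"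


section \<open>Rank one perturbations of multiplication by the variable\<close>

text \<open>An unbounded operator is given by its graph, a set of pairs of square integrable functions
  that is closed under changes on null sets.\<close>

type_synonym l2_operator = "((real \<Rightarrow> complex) \<times> (real \<Rightarrow> complex)) set"

definition hamiltonian :: "(real \<Rightarrow> complex) \<Rightarrow> real \<Rightarrow> l2_operator" where
  "hamiltonian u \<alpha> =
     {(f, g). f \<in> l2 \<and> (\<lambda>x. of_real x * f x) \<in> l2 \<and> g \<in> l2 \<and>
        (AE x in lborel. g x = of_real x * f x + of_real \<alpha> * l2_inner f u * u x)}"


section \<open>Unitary groups and scattering\<close>

definition unitary_group :: "(real \<Rightarrow> (real \<Rightarrow> complex) \<Rightarrow> (real \<Rightarrow> complex)) \<Rightarrow> bool" where
  "unitary_group U \<longleftrightarrow>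
     (\<forall>t. \<forall>f\<in>l2. U t f \<in> l2) \<and>
     (\<forall>t a b. \<forall>f\<in>l2. \<forall>g\<in>l2.
        AE x in lborel. U t (\<lambda>y. a * f y + b * g y) x = a * U t f x + b * U t g x) \<and>
     (\<forall>t. \<forall>f\<in>l2. \<forall>g\<in>l2. l2_inner (U t f) (U t g) = l2_inner f g) \<and>
     (\<forall>f\<in>l2. AE x in lborel. U 0 f x = f x) \<and>
     (\<forall>s t. \<forall>f\<in>l2. AE x in lborel. U (s + t) f x = U s (U t f) x) \<and>
     (\<forall>f\<in>l2. l2_tendsto (\<lambda>t. U t f) f (at 0))"

text \<open>\<open>U t\<close> is the exponential of \<open>\<i> t A\<close>: by Stone's theorem, for self-adjoint \<open>A\<close> there is exactly
  one strongly continuous unitary group (up to null sets) whose infinitesimal generator, including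
  its domain, is \<open>\<i> A\<close>.\<close>

definition is_exp_group ::
  "l2_operator \<Rightarrow> (real \<Rightarrow> (real \<Rightarrow> complex) \<Rightarrow> (real \<Rightarrow> complex)) \<Rightarrow> bool" where
  "is_exp_group A U \<longleftrightarrow> unitary_group U \<and>
     A = {(f, g). f \<in> l2 \<and> g \<in> l2 \<and>
            l2_tendsto (\<lambda>t x. (U t f x - f x) / of_real t) (\<lambda>x. \<i> * g x) (at 0)}"

text \<open>\<open>W\<close> is the strong limit of \<open>exp (\<i> t A) exp (- \<i> t B)\<close> along a filter on the times \<open>t\<close>, where
  \<open>U\<close> and \<open>V\<close> are the groups of \<open>A\<close> and \<open>B\<close>.\<close>

definition is_wave_operator ::
  "(real \<Rightarrow> (real \<Rightarrow> complex) \<Rightarrow> (real \<Rightarrow> complex)) \<Rightarrow>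
   (real \<Rightarrow> (real \<Rightarrow> complex) \<Rightarrow> (real \<Rightarrow> complex)) \<Rightarrow> real filter \<Rightarrow>
   ((real \<Rightarrow> complex) \<Rightarrow> (real \<Rightarrow> complex)) \<Rightarrow> bool" where
  "is_wave_operator U V Fl W \<longleftrightarrow>
     (\<forall>f\<in>l2. W f \<in> l2 \<and> l2_tendsto (\<lambda>t. U t (V (- t) f)) (W f) Fl)"

text \<open>The wave operators \<open>Wp\<close>, \<open>Wm\<close> of the pair \<open>A\<close>, \<open>B\<close> exist and the scattering operator, the
  adjoint of \<open>Wp\<close> composed with \<open>Wm\<close>, is multiplication by \<open>s\<close>.  This determines \<open>s\<close> only up to
  null sets.\<close>

definition scattering_is_mult_by ::
  "l2_operator \<Rightarrow> l2_operator \<Rightarrow> (real \<Rightarrow> complex) \<Rightarrow> bool" where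
  "scattering_is_mult_by A B s \<longleftrightarrow>
     (\<exists>U V Wp Wm. is_exp_group A U \<and> is_exp_group B V \<and>
        is_wave_operator U V at_top Wp \<and> is_wave_operator U V at_bot Wm \<and>
        (\<forall>f\<in>l2. (\<lambda>x. s x * f x) \<in> l2) \<and>
        (\<forall>f\<in>l2. \<forall>g\<in>l2. l2_inner (\<lambda>x. s x * f x) g = l2_inner (Wm f) (Wp g)))"


section \<open>The functions attached to the perturbation\<close>

definition F1 :: "(real \<Rightarrow> complex) \<Rightarrow> real \<Rightarrow> real \<Rightarrow> real" where
  "F1 u \<alpha> l = 1 + \<alpha> * pv (\<lambda>x. (cmod (u x))\<^sup>2) l"

definition F2 :: "(real \<Rightarrow> complex) \<Rightarrow> real \<Rightarrow> real \<Rightarrow> real" where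
  "F2 u \<alpha> l = \<alpha> * pi * (cmod (u l))\<^sup>2"

definition F :: "(real \<Rightarrow> complex) \<Rightarrow> real \<Rightarrow> real \<Rightarrow> complex" where
  "F u \<alpha> l = of_real (F1 u \<alpha> l) + \<i> * of_real (F2 u \<alpha> l)"

definition phi :: "(real \<Rightarrow> complex) \<Rightarrow> real \<Rightarrow> real \<Rightarrow> complex" where
  "phi u l\<^sub>0 x = (if x = l\<^sub>0 then vector_derivative u (at l\<^sub>0) else u x / of_real (x - l\<^sub>0))"

definition kappa :: "(real \<Rightarrow> complex) \<Rightarrow> real \<Rightarrow> (real \<Rightarrow> real) \<Rightarrow> real \<Rightarrow> real" where
  "kappa u l\<^sub>0 lam \<alpha> = pi * (cmod (u (lam \<alpha>)))\<^sup>2 / (l2_norm (phi u l\<^sub>0))\<^sup>2"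

definition lam_shift ::
  "(real \<Rightarrow> complex) \<Rightarrow> real \<Rightarrow> (real \<Rightarrow> real) \<Rightarrow> real \<Rightarrow> real \<Rightarrow> real" where
  "lam_shift u l\<^sub>0 lam h \<alpha> = lam \<alpha> + h * kappa u l\<^sub>0 lam \<alpha>"

end

theory Submission
  imports Defs "HOL-Probability.Sinc_Integral"
begin

text \<open>Write \<open>g = |u|\<^sup>2\<close> and \<open>G\<close> for its principal value transform, so that
  \<open>G l\<close> is half the integral of \<open>(g (l + t) - g (l - t)) / t\<close>.  Dominated convergence shows that
  \<open>G\<close> is strictly differentiable at \<open>l\<^sub>0\<close>, and an integration by parts identifies its derivative
  there with the integral of \<open>g x / (x - l\<^sub>0)\<^sup>2\<close>, the squared norm of \<open>\<phi>\<close>.  With \<open>a = \<lambda>(\<alpha>)\<close> and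
  \<open>b = \<lambda>\<^sub>h(\<alpha>)\<close> the equation \<open>1 + \<alpha> G(a) = 0\<close> turns the value of \<open>R\<close> at \<open>b\<close> into
  \<open>- 2 \<i> r / (q + \<i> r)\<close>, where \<open>r = g b / g a\<close> and \<open>q = (G b - G a) / (\<pi> g a)\<close>.  Since
  \<open>b - a\<close> is \<open>h \<pi> g a / \<parallel>\<phi>\<parallel>\<^sup>2\<close>, strict differentiability of \<open>G\<close> gives \<open>q \<longlonglongrightarrow> h\<close>, and
  \<open>r \<longlonglongrightarrow> 1\<close> because \<open>g'(l\<^sub>0) = 0\<close>.\<close>


section \<open>Symmetric difference quotients of decaying functions\<close>

lemma integrable_inverse_one_plus_square:
  "integrable lborel (\<lambda>x::real. c / (1 + x\<^sup>2))"
  using integrable_mult_right[OF integrable_inverse_1_plus_square[unfolded set_integrable_def], of c]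
  by (simp add: divide_inverse)

lemma integrable_of_quadratic_decay:
  fixes f :: "real \<Rightarrow> real"
  assumes "f \<in> borel_measurable borel" and decay: "\<And>x. \<bar>f x\<bar> \<le> c / (1 + x\<^sup>2)"
  shows "integrable lborel f"
proof (rule Bochner_Integration.integrable_bound[OF integrable_inverse_one_plus_square[of c]])
  show "AE x in lborel. norm (f x) \<le> norm (c / (1 + x\<^sup>2))"
    using order_trans[OF decay abs_ge_self] by simp
qed (use assms in simp)

text \<open>Twice (1 + l^2) (1 + (l + t)^2) exceeds 1 + t^2 by one plus two squares. Translation
  thus costs only a factor depending on \<open>l\<close>, which keeps later bounds uniform for
  \<open>l\<close> in a bounded set.\<close>

lemma quadratic_decay_shift:
  fixes f :: "real \<Rightarrow> real"
  assumes "\<And>x. \<bar>f x\<bar> \<le> C / (1 + x\<^sup>2)"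
  shows "\<bar>f (l + t)\<bar> \<le> 2 * C * (1 + l\<^sup>2) / (1 + t\<^sup>2)"
proof -
  have "2 * (1 + l\<^sup>2) * (1 + (l + t)\<^sup>2) - (1 + t\<^sup>2) = 1 + (2 * l + t)\<^sup>2 + 2 * (l * (l + t))\<^sup>2"
    by (simp add: power2_eq_square algebra_simps)
  then have "1 + t\<^sup>2 \<le> 2 * (1 + l\<^sup>2) * (1 + (l + t)\<^sup>2)"
    using zero_le_power2[of "2 * l + t"] zero_le_power2[of "l * (l + t)"] by linarith
  moreover have C: "0 \<le> C" using assms[of 0] by simp
  ultimately have "C * (1 + t\<^sup>2) \<le> C * (2 * (1 + l\<^sup>2) * (1 + (l + t)\<^sup>2))"
    by (rule mult_left_mono)
  moreover have "0 < 1 + t\<^sup>2" "0 < 1 + (l + t)\<^sup>2"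
    by (auto intro: add_pos_nonneg)
  ultimately have "C / (1 + (l + t)\<^sup>2) \<le> 2 * C * (1 + l\<^sup>2) / (1 + t\<^sup>2)"
    by (simp add: pos_divide_le_eq pos_le_divide_eq) (simp add: algebra_simps)
  with assms[of "l + t"] show ?thesis by linarith
qed

text \<open>Folding the principal value integral about \<open>l\<close> turns the kernel 1 / (x - l)
  into this quotient, which stays bounded near \<open>t = 0\<close> when \<open>f\<close> is
  Lipschitz. At \<open>t = 0\<close> division by zero gives the value 0.\<close>

definition sym_quot :: "(real \<Rightarrow> real) \<Rightarrow> real \<Rightarrow> real \<Rightarrow> real" where
  "sym_quot f l t = (f (l + t) - f (l - t)) / t"

text \<open>A mean value theorem without an order on \<open>a\<close> and \<open>b\<close>, for use
  along sequences whose two points may come in either order or coincide. The weak inequality admits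
  \<open>z = a\<close> in the equal case.\<close>

lemma mean_value_between:
  fixes f f' :: "real \<Rightarrow> real"
  assumes "\<And>x. (f has_real_derivative f' x) (at x)"
  obtains z where "\<bar>z - a\<bar> \<le> \<bar>b - a\<bar>" "f b - f a = (b - a) * f' z"
proof (cases a b rule: linorder_cases)
  case less
  then obtain z where "a < z" "z < b" "f b - f a = (b - a) * f' z"
    using MVT2[of a b f f'] assms by auto
  then show ?thesis by (intro that[of z]) auto
next
  case equal
  then show ?thesis by (intro that[of a]) auto
next
  case greater
  then obtain z where "b < z" "z < a" "f a - f b = (a - b) * f' z"
    using MVT2[of b a f f'] assms by auto
  then show ?thesis by (intro that[of z]) (auto simp: algebra_simps)
qed

text \<open>Glues a constant bound near the origin to decay far away: for
  \<open>\<bar>t\<bar> \<le> 1\<close> the factor 1 + t^2 is at most 2, which turns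
  \<open>2 * C\<close> into \<open>4 * C\<close>.\<close>

lemma decay_from_local_bound:
  fixes C l t y :: real
  assumes C: "0 \<le> C" and near: "\<bar>t\<bar> \<le> 1 \<Longrightarrow> \<bar>y\<bar> \<le> 2 * C"
    and far: "1 \<le> \<bar>t\<bar> \<Longrightarrow> \<bar>y\<bar> \<le> 4 * C * (1 + l\<^sup>2) / (1 + t\<^sup>2)"
  shows "\<bar>y\<bar> \<le> 4 * C * (1 + l\<^sup>2) / (1 + t\<^sup>2)"
proof (cases "\<bar>t\<bar> \<le> 1")
  case True
  then have "t\<^sup>2 \<le> 1" by (simp add: abs_square_le_1)
  then have "2 * C * (1 + t\<^sup>2) \<le> 2 * C * 2"
    using C by (intro mult_left_mono) auto
  also have "\<dots> \<le> 4 * C * (1 + l\<^sup>2)" using C by (simp add: algebra_simps)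
  finally have "2 * C \<le> 4 * C * (1 + l\<^sup>2) / (1 + t\<^sup>2)"
    by (simp add: pos_le_divide_eq add_pos_nonneg)
  with near[OF True] show ?thesis by linarith
qed (use far in simp)

text \<open>Near \<open>t = 0\<close> the mean value theorem gives twice a value of
  \<open>f'\<close>; for \<open>\<bar>t\<bar> \<ge> 1\<close> the division only helps and both
  shifted values decay. The dependence on \<open>l\<close> is explicit because the bound must later
  dominate a whole sequence of centres.\<close>

lemma abs_sym_quot_le:
  fixes f f' :: "real \<Rightarrow> real"
  assumes deriv: "\<And>x. (f has_real_derivative f' x) (at x)"
    and f: "\<And>x. \<bar>f x\<bar> \<le> C / (1 + x\<^sup>2)"
    and f': "\<And>x. \<bar>f' x\<bar> \<le> C"
  shows "\<bar>sym_quot f l t\<bar> \<le> 4 * C * (1 + l\<^sup>2) / (1 + t\<^sup>2)"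
proof (rule decay_from_local_bound)
  show C: "0 \<le> C" using f[of 0] by simp
  obtain z where "f (l + t) - f (l - t) = (l + t - (l - t)) * f' z"
    using mean_value_between[OF deriv] by blast
  then have "sym_quot f l t = (if t = 0 then 0 else 2 * f' z)"
    by (simp add: sym_quot_def)
  with f'[of z] C show "\<bar>sym_quot f l t\<bar> \<le> 2 * C" by (simp add: abs_mult)
next
  assume t: "1 \<le> \<bar>t\<bar>"
  have "\<bar>f (l + t)\<bar> \<le> 2 * C * (1 + l\<^sup>2) / (1 + t\<^sup>2)" "\<bar>f (l - t)\<bar> \<le> 2 * C * (1 + l\<^sup>2) / (1 + t\<^sup>2)"
    using quadratic_decay_shift[OF f, of l t] quadratic_decay_shift[OF f, of l "- t"] by auto
  then have "\<bar>f (l + t) - f (l - t)\<bar> \<le> 4 * C * (1 + l\<^sup>2) / (1 + t\<^sup>2)"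
    by (simp add: mult.assoc)
  moreover have "\<bar>sym_quot f l t\<bar> \<le> \<bar>f (l + t) - f (l - t)\<bar>"
    using t divide_left_mono[of 1 "\<bar>t\<bar>" "\<bar>f (l + t) - f (l - t)\<bar>"]
    by (auto simp: sym_quot_def abs_divide)
  ultimately show "\<bar>sym_quot f l t\<bar> \<le> 4 * C * (1 + l\<^sup>2) / (1 + t\<^sup>2)" by linarith
qed

lemma has_derivative_sym_quot:
  assumes deriv: "\<And>x. (f has_real_derivative f' x) (at x)"
  shows "((\<lambda>l. sym_quot f l t) has_real_derivative sym_quot f' l t) (at l)"
  unfolding sym_quot_def
  by (rule DERIV_cdivide)
    (auto intro!: derivative_eq_intros DERIV_chain2[where f = f, OF deriv])

text \<open>The fundamental theorem of calculus on each half-line, glued across the null set {0}.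
  The origin enters only through a limit, since the intended antiderivative is a quotient by
  \<open>t\<close>.\<close>

lemma integral_derivative_punctured_line:
  fixes P f :: "real \<Rightarrow> real"
  assumes deriv: "\<And>t. t \<noteq> 0 \<Longrightarrow> (P has_real_derivative f t) (at t)"
    and cont: "\<And>t. t \<noteq> 0 \<Longrightarrow> isCont f t"
    and int: "integrable lborel f"
    and lim: "(P \<longlongrightarrow> 0) (at 0)" "(P \<longlongrightarrow> 0) at_top" "(P \<longlongrightarrow> 0) at_bot"
  shows "(LINT t|lborel. f t) = 0"
proof -
  have seti: "set_integrable lborel A f" if "A \<in> sets borel" for A
    unfolding set_integrable_def by (rule integrable_mult_indicator) (use int that in auto)
  have lim0: "(P \<longlongrightarrow> 0) (at_right 0)" "(P \<longlongrightarrow> 0) (at_left 0)"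
    using lim(1) by (auto simp: filterlim_at_split)
  have "(LBINT t=ereal 0..\<infinity>. f t) = 0 - 0"
    by (rule interval_integral_FTC_integrable[where F = P])
      (use deriv cont lim lim0 in \<open>auto simp: has_real_derivative_iff_has_vector_derivative[symmetric]
         ereal_tendsto_simps intro!: seti\<close>)
  then have pos: "(LINT t:{0<..}|lborel. f t) = 0"
    by (simp add: interval_lebesgue_integral_def)
  have "(LBINT t=-\<infinity>..ereal 0. f t) = 0 - 0"
    by (rule interval_integral_FTC_integrable[where F = P])
      (use deriv cont lim lim0 in \<open>auto simp: has_real_derivative_iff_has_vector_derivative[symmetric]
         ereal_tendsto_simps intro!: seti\<close>)
  then have neg: "(LINT t:{..<0}|lborel. f t) = 0"
    by (simp add: interval_lebesgue_integral_def)
  have "(LINT t|lborel. f t) = (LINT t:{..<0} \<union> {0<..}|lborel. f t)"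
    unfolding set_lebesgue_integral_def
    by (rule integral_cong_AE)
      (use int AE_lborel_singleton[of "0::real"] in
        \<open>auto intro!: borel_measurable_integrable integrable_mult_indicator
          elim!: eventually_mono simp: indicator_def\<close>)
  also have "\<dots> = 0"
    by (subst set_integral_Un) (auto intro!: seti simp: pos neg)
  finally show ?thesis .
qed

section \<open>The principal value transform of a decaying C^2 function\<close>

locale decaying_C2 =
  fixes g g' g'' :: "real \<Rightarrow> real" and C :: real
  assumes deriv: "\<And>x. (g has_real_derivative g' x) (at x)"
    and deriv': "\<And>x. (g' has_real_derivative g'' x) (at x)"
    and bound: "\<And>x. \<bar>g x\<bar> \<le> C / (1 + x\<^sup>2)"
    and bound': "\<And>x. \<bar>g' x\<bar> \<le> C / (1 + x\<^sup>2)"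
    and bound'': "\<And>x. \<bar>g'' x\<bar> \<le> C / (1 + x\<^sup>2)"
begin

lemma C_nonneg: "0 \<le> C"
  using bound[of 0] by simp

lemma le_C: "\<bar>g' x\<bar> \<le> C" "\<bar>g'' x\<bar> \<le> C"
proof -
  have "C / (1 + x\<^sup>2) \<le> C / 1"
    using C_nonneg by (intro divide_left_mono) (auto intro: add_pos_nonneg)
  then show "\<bar>g' x\<bar> \<le> C" "\<bar>g'' x\<bar> \<le> C"
    using bound'[of x] bound''[of x] by auto
qed

lemma isCont: "isCont g x" and isCont': "isCont g' x"
  using deriv deriv' by (auto intro: DERIV_isCont)

lemma measurable_g [measurable]: "g \<in> borel_measurable borel"
  and measurable_g' [measurable]: "g' \<in> borel_measurable borel"
  by (auto intro!: borel_measurable_continuous_onI continuous_at_imp_continuous_on isCont isCont')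

lemma measurable_sym_quot [measurable]:
  "sym_quot g l \<in> borel_measurable borel" "sym_quot g' l \<in> borel_measurable borel"
  unfolding sym_quot_def by measurable

text \<open>The bound on \<open>g''\<close> does for the quotient of \<open>g'\<close> what the
  bound on \<open>g'\<close> does for the quotient of \<open>g\<close>.\<close>

lemma integrable_sym_quot:
  "integrable lborel (sym_quot g l)" "integrable lborel (sym_quot g' l)"
  by (rule integrable_of_quadratic_decay,
      auto intro: abs_sym_quot_le[OF deriv bound le_C(1)] abs_sym_quot_le[OF deriv' bound' le_C(2)])+

text \<open>The truncation is symmetric about \<open>l\<close>, so twice the integral is the sum of
  its forms under x = l + t and x = l - t. The cutoff bounds the kernel by
  \<open>1 / \<epsilon>\<close>, which makes all pieces integrable.\<close>

lemma truncated_integral_eq: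
  assumes "0 < \<epsilon>"
  shows "(LINT x:{x. \<epsilon> \<le> \<bar>x - l\<bar>}|lborel. g x /\<^sub>R (x - l)) =
    (LINT t|lborel. indicator {t. \<epsilon> \<le> \<bar>t\<bar>} t * sym_quot g l t) / 2"
proof -
  define w where "w x = indicator {x. \<epsilon> \<le> \<bar>x - l\<bar>} x * (g x / (x - l))" for x
  have w_measurable [measurable]: "w \<in> borel_measurable borel" unfolding w_def by measurable
  have "\<bar>w x\<bar> \<le> (C / \<epsilon>) / (1 + x\<^sup>2)" for x
  proof (cases "\<epsilon> \<le> \<bar>x - l\<bar>")
    case True
    have "\<bar>w x\<bar> = \<bar>g x\<bar> / \<bar>x - l\<bar>" using True by (simp add: w_def)
    also have "\<dots> \<le> (C / (1 + x\<^sup>2)) / \<epsilon>"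
      using True assms bound[of x] by (intro frac_le) auto
    finally show ?thesis by (simp add: mult.commute)
  qed (use assms C_nonneg in \<open>simp add: w_def\<close>)
  then have int: "integrable lborel w"
    by (rule integrable_of_quadratic_decay[OF w_measurable])
  have "(LINT x|lborel. w x) + (LINT x|lborel. w x) =
      (LINT t|lborel. w (l + t)) + (LINT t|lborel. w (l - t))"
    using lborel_integral_real_affine[of 1 w l] lborel_integral_real_affine[of "-1" w l] by simp
  also have "\<dots> = (LINT t|lborel. w (l + t) + w (l - t))"
    using lborel_integrable_real_affine[OF int, of 1 l] lborel_integrable_real_affine[OF int, of "-1" l]
    by (intro Bochner_Integration.integral_add[symmetric]) auto
  also have "(\<lambda>t. w (l + t) + w (l - t)) = (\<lambda>t. indicator {t. \<epsilon> \<le> \<bar>t\<bar>} t * sym_quot g l t)"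
    by (auto simp: w_def sym_quot_def indicator_def diff_divide_distrib)
  finally have "(LINT x|lborel. w x) = (LINT t|lborel. indicator {t. \<epsilon> \<le> \<bar>t\<bar>} t * sym_quot g l t) / 2"
    by linarith
  moreover have "(LINT x:{x. \<epsilon> \<le> \<bar>x - l\<bar>}|lborel. g x /\<^sub>R (x - l)) = (LINT x|lborel. w x)"
    unfolding set_lebesgue_integral_def w_def
    by (rule Bochner_Integration.integral_cong) (simp_all add: divide_inverse)
  ultimately show ?thesis by simp
qed

text \<open>Dominated convergence with dominating function
  \<open>\<bar>sym_quot g l t\<bar>\<close>: for \<open>t \<noteq> 0\<close> the cutoff is
  eventually 1, and at \<open>t = 0\<close> the quotient is 0. This also shows that the
  \<open>Lim\<close> in \<open>pv\<close> is a genuine limit.\<close>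

lemma pv_eq: "pv g l = (LINT t|lborel. sym_quot g l t) / 2"
proof -
  have "((\<lambda>\<epsilon>. LINT t|lborel. indicator {t. \<epsilon> \<le> \<bar>t\<bar>} t * sym_quot g l t)
      \<longlongrightarrow> (LINT t|lborel. sym_quot g l t)) (at_right 0)"
  proof (rule tendsto_at_right_sequentially[of _ 1])
    fix S :: "nat \<Rightarrow> real"
    assume S: "\<And>n. 0 < S n" "S \<longlonglongrightarrow> 0"
    show "(\<lambda>n. LINT t|lborel. indicator {t. S n \<le> \<bar>t\<bar>} t * sym_quot g l t)
        \<longlonglongrightarrow> (LINT t|lborel. sym_quot g l t)"
    proof (rule integral_dominated_convergence[where w = "\<lambda>t. \<bar>sym_quot g l t\<bar>"])
      show "AE t in lborel. (\<lambda>n. indicator {t. S n \<le> \<bar>t\<bar>} t * sym_quot g l t) \<longlonglongrightarrow> sym_quot g l t"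
      proof (rule AE_I2)
        fix t :: real
        show "(\<lambda>n. indicator {t. S n \<le> \<bar>t\<bar>} t * sym_quot g l t) \<longlonglongrightarrow> sym_quot g l t"
        proof (cases "t = 0")
          case False
          then have "\<forall>\<^sub>F n in sequentially. S n < \<bar>t\<bar>"
            using order_tendstoD(2)[OF S(2), of "\<bar>t\<bar>"] by simp
          then show ?thesis
            by (intro tendsto_eventually, elim eventually_mono) simp
        qed (simp add: sym_quot_def)
      qed
      show "integrable lborel (\<lambda>t. \<bar>sym_quot g l t\<bar>)"
        using integrable_sym_quot by auto
    qed (auto simp: indicator_def)
  qed auto
  then have "((\<lambda>\<epsilon>. (LINT t|lborel. indicator {t. \<epsilon> \<le> \<bar>t\<bar>} t * sym_quot g l t) / 2)
      \<longlongrightarrow> (LINT t|lborel. sym_quot g l t) / 2) (at_right 0)"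
    by (intro tendsto_intros) auto
  then have "((\<lambda>\<epsilon>. LINT x:{x. \<epsilon> \<le> \<bar>x - l\<bar>}|lborel. g x /\<^sub>R (x - l))
      \<longlongrightarrow> (LINT t|lborel. sym_quot g l t) / 2) (at_right 0)"
    by (rule Lim_transform_eventually)
      (rule eventually_mono[OF eventually_at_right_less[of 0]], simp only: truncated_integral_eq)
  then show ?thesis
    unfolding pv_def by (intro tendsto_Lim) auto
qed

text \<open>Both endpoints move, because neither the root of \<open>F1\<close> nor the shifted point
  stays at the resonance. Differentiation passes under the integral by dominated convergence, the
  mean value theorem turning difference quotients into values of \<open>sym_quot g'\<close> at
  intermediate points.\<close>

lemma pv_strict_derivative:
  fixes a b :: "nat \<Rightarrow> real"
  assumes a: "a \<longlonglongrightarrow> l" and b: "b \<longlonglongrightarrow> l" and ne: "\<forall>\<^sub>F n in sequentially. a n \<noteq> b n"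
  shows "(\<lambda>n. (pv g (b n) - pv g (a n)) / (b n - a n)) \<longlonglongrightarrow> (LINT t|lborel. sym_quot g' l t) / 2"
proof -
  obtain B where B: "\<And>n. \<bar>a n\<bar> \<le> B" "\<And>n. \<bar>b n\<bar> \<le> B"
  proof -
    obtain A A' where "\<And>n. \<bar>a n\<bar> \<le> A" "\<And>n. \<bar>b n\<bar> \<le> A'"
      using convergent_imp_Bseq[OF convergentI[OF a]] convergent_imp_Bseq[OF convergentI[OF b]]
      by (auto simp: Bseq_def)
    then show ?thesis by (intro that[of "max A A'"]) (auto simp: le_max_iff_disj)
  qed
  let ?q = "\<lambda>n t. (sym_quot g (b n) t - sym_quot g (a n) t) / (b n - a n)"
  have "\<exists>z. \<bar>z - a n\<bar> \<le> \<bar>b n - a n\<bar> \<and>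
      sym_quot g (b n) t - sym_quot g (a n) t = (b n - a n) * sym_quot g' z t" for t n
    by (rule mean_value_between[OF has_derivative_sym_quot[OF deriv]]) blast
  then have "\<exists>z. \<forall>t n. \<bar>z t n - a n\<bar> \<le> \<bar>b n - a n\<bar> \<and>
      sym_quot g (b n) t - sym_quot g (a n) t = (b n - a n) * sym_quot g' (z t n) t"
    by (intro choice allI)
  then obtain z where z: "\<And>t n. \<bar>z t n - a n\<bar> \<le> \<bar>b n - a n\<bar>"
      "\<And>t n. sym_quot g (b n) t - sym_quot g (a n) t = (b n - a n) * sym_quot g' (z t n) t"
    by blast
  \<comment> \<open>When \<open>a n = b n\<close> the quotient is 0 by division by zero; by
    \<open>ne\<close> this is not the case for large \<open>n\<close>.\<close>
  have q: "?q n t = (if a n = b n then 0 else sym_quot g' (z t n) t)" for n t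
    by (simp add: z(2))
  have "(\<lambda>n. LINT t|lborel. ?q n t) \<longlonglongrightarrow> (LINT t|lborel. sym_quot g' l t)"
  \<comment> \<open>The radius \<open>3 * B\<close> bounds all intermediate points: at most
    \<open>B\<close> for \<open>a n\<close> and \<open>2 * B\<close> for the distance to
    \<open>b n\<close>.\<close>
  proof (rule integral_dominated_convergence[where w = "\<lambda>t. 4 * C * (1 + (3 * B)\<^sup>2) / (1 + t\<^sup>2)"])
    show "AE t in lborel. (\<lambda>n. ?q n t) \<longlonglongrightarrow> sym_quot g' l t"
    proof (rule AE_I2)
      fix t
      have "(\<lambda>n. z t n - a n) \<longlonglongrightarrow> 0"
      proof (rule Lim_null_comparison)
        show "\<forall>\<^sub>F n in sequentially. norm (z t n - a n) \<le> \<bar>b n - a n\<bar>"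
          using z(1) by simp
        show "(\<lambda>n. \<bar>b n - a n\<bar>) \<longlonglongrightarrow> 0"
          using tendsto_rabs[OF tendsto_diff[OF b a]] by simp
      qed
      from tendsto_add[OF this a] have "z t \<longlonglongrightarrow> l" by simp
      moreover have "isCont (\<lambda>l. sym_quot g' l t) l"
        by (rule DERIV_isCont[OF has_derivative_sym_quot[OF deriv']])
      ultimately have "(\<lambda>n. sym_quot g' (z t n) t) \<longlonglongrightarrow> sym_quot g' l t"
        using isCont_tendsto_compose[of l "\<lambda>l. sym_quot g' l t"] by blast
      then show "(\<lambda>n. ?q n t) \<longlonglongrightarrow> sym_quot g' l t"
        by (rule Lim_transform_eventually) (use ne in \<open>auto elim!: eventually_mono simp: q\<close>)
    qed
    show "AE t in lborel. norm (?q n t) \<le> 4 * C * (1 + (3 * B)\<^sup>2) / (1 + t\<^sup>2)" for n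
    proof (rule AE_I2)
      fix t
      have "\<bar>z t n\<bar> \<le> 3 * B" using z(1)[of t n] B(1)[of n] B(2)[of n] by linarith
      then have "(z t n)\<^sup>2 \<le> (3 * B)\<^sup>2" by (rule power2_le_iff_abs_le[THEN iffD2, rotated]) (use B(1)[of 0] in linarith)
      then have "4 * C * (1 + (z t n)\<^sup>2) / (1 + t\<^sup>2) \<le> 4 * C * (1 + (3 * B)\<^sup>2) / (1 + t\<^sup>2)"
        using C_nonneg by (intro divide_right_mono mult_left_mono) auto
      then show "norm (?q n t) \<le> 4 * C * (1 + (3 * B)\<^sup>2) / (1 + t\<^sup>2)"
        using abs_sym_quot_le[OF deriv' bound' le_C(2), of "z t n" t] C_nonneg
        unfolding q by auto
    qed
  qed (auto intro: integrable_inverse_one_plus_square)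
  then have "(\<lambda>n. (LINT t|lborel. ?q n t) / 2) \<longlonglongrightarrow> (LINT t|lborel. sym_quot g' l t) / 2"
    by (intro tendsto_intros) auto
  moreover have "(LINT t|lborel. ?q n t) / 2 = (pv g (b n) - pv g (a n)) / (b n - a n)" for n
    by (simp add: pv_eq integrable_sym_quot diff_divide_distrib mult.commute)
  ultimately show ?thesis by simp
qed

section \<open>Integration by parts at a double zero\<close>

context
  fixes l :: real
  assumes zero: "g l = 0" "g' l = 0"
begin

lemma double_zero_bounds: "\<bar>g' (l + t)\<bar> \<le> C * \<bar>t\<bar>" "\<bar>g (l + t)\<bar> \<le> C * t\<^sup>2"
proof -
  \<comment> \<open>Stated for every \<open>t\<close>, since the estimate for \<open>g\<close>
    applies it at the intermediate point \<open>z - l\<close>.\<close>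
  have *: "\<bar>g' (l + t)\<bar> \<le> C * \<bar>t\<bar>" for t
  proof -
    obtain z where "g' (l + t) - g' l = (l + t - l) * g'' z"
      using mean_value_between[OF deriv'] by blast
    then show ?thesis
      using zero le_C(2)[of z] by (simp add: abs_mult mult.commute[of C] mult_left_mono)
  qed
  then show "\<bar>g' (l + t)\<bar> \<le> C * \<bar>t\<bar>" .
  obtain z where z: "\<bar>z - l\<bar> \<le> \<bar>l + t - l\<bar>" "g (l + t) - g l = (l + t - l) * g' z"
    using mean_value_between[OF deriv] by blast
  have "\<bar>g' z\<bar> \<le> C * \<bar>t\<bar>"
    using *[of "z - l"] z(1) mult_left_mono[OF _ C_nonneg, of "\<bar>z - l\<bar>" "\<bar>t\<bar>"] by simp
  then have "\<bar>t\<bar> * \<bar>g' z\<bar> \<le> \<bar>t\<bar> * (C * \<bar>t\<bar>)" by (rule mult_left_mono) simp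
  then show "\<bar>g (l + t)\<bar> \<le> C * t\<^sup>2"
    using z(2) zero by (simp add: abs_mult power2_eq_square mult_ac)
qed

text \<open>The double zero absorbs the denominators near the origin, and the decay of
  \<open>g\<close> and \<open>g'\<close> takes over for
  \<open>\<bar>t\<bar> \<ge> 1\<close>.\<close>

lemma integrable_double_zero:
  "integrable lborel (\<lambda>t. g' (l + t) / t)" "integrable lborel (\<lambda>t. g (l + t) / t\<^sup>2)"
proof -
  have near: "\<bar>g' (l + t) / t\<bar> \<le> 2 * C" "\<bar>g (l + t) / t\<^sup>2\<bar> \<le> 2 * C" for t
  proof -
    have "\<bar>g' (l + t) / t\<bar> \<le> C" "\<bar>g (l + t) / t\<^sup>2\<bar> \<le> C"
      using double_zero_bounds[of t] C_nonneg
      by (cases "t = 0"; simp add: abs_divide pos_divide_le_eq)+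
    then show "\<bar>g' (l + t) / t\<bar> \<le> 2 * C" "\<bar>g (l + t) / t\<^sup>2\<bar> \<le> 2 * C"
      using C_nonneg by auto
  qed
  have far: "\<bar>g' (l + t) / t\<bar> \<le> 4 * C * (1 + l\<^sup>2) / (1 + t\<^sup>2)"
    "\<bar>g (l + t) / t\<^sup>2\<bar> \<le> 4 * C * (1 + l\<^sup>2) / (1 + t\<^sup>2)" if "1 \<le> \<bar>t\<bar>" for t
  proof -
    have "1 \<le> t\<^sup>2" using that by (simp add: abs_le_square_iff[of 1 t, simplified])
    then have "\<bar>g' (l + t) / t\<bar> \<le> \<bar>g' (l + t)\<bar>" "\<bar>g (l + t) / t\<^sup>2\<bar> \<le> \<bar>g (l + t)\<bar>"
      using that divide_left_mono[of 1 "\<bar>t\<bar>" "\<bar>g' (l + t)\<bar>"] divide_left_mono[of 1 "t\<^sup>2" "\<bar>g (l + t)\<bar>"]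
      by (auto simp: abs_divide)
    moreover have "2 * C * (1 + l\<^sup>2) / (1 + t\<^sup>2) \<le> 4 * C * (1 + l\<^sup>2) / (1 + t\<^sup>2)"
      using C_nonneg by (intro divide_right_mono mult_right_mono) auto
    ultimately show "\<bar>g' (l + t) / t\<bar> \<le> 4 * C * (1 + l\<^sup>2) / (1 + t\<^sup>2)"
      "\<bar>g (l + t) / t\<^sup>2\<bar> \<le> 4 * C * (1 + l\<^sup>2) / (1 + t\<^sup>2)"
      using quadratic_decay_shift[OF bound, of l t] quadratic_decay_shift[OF bound', of l t]
      by linarith+
  qed
  show "integrable lborel (\<lambda>t. g' (l + t) / t)"
    by (rule integrable_of_quadratic_decay[OF _ decay_from_local_bound[OF C_nonneg near(1) far(1)]]) measurable
  show "integrable lborel (\<lambda>t. g (l + t) / t\<^sup>2)"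
    by (rule integrable_of_quadratic_decay[OF _ decay_from_local_bound[OF C_nonneg near(2) far(2)]]) measurable
qed

text \<open>The difference of the integrands is the derivative of \<open>g (l + t) / t\<close>. This
  function is at most \<open>C * \<bar>t\<bar>\<close> near 0 by the double zero and at most
  \<open>C / \<bar>t\<bar>\<close> at infinity, so no boundary term survives.\<close>

lemma integral_by_parts_double_zero:
  "(LINT t|lborel. g' (l + t) / t) = (LINT t|lborel. g (l + t) / t\<^sup>2)"
proof -
  have "(LINT t|lborel. g' (l + t) / t - g (l + t) / t\<^sup>2) = 0"
  proof (rule integral_derivative_punctured_line[where P = "\<lambda>t. g (l + t) / t"])
    fix t :: real
    assume t: "t \<noteq> 0"
    have shift: "((\<lambda>t. g (l + t)) has_real_derivative g' (l + t)) (at t)"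
      "((\<lambda>t. g' (l + t)) has_real_derivative g'' (l + t)) (at t)"
      using DERIV_shift[of g _ t l] deriv[of "t + l"]
        DERIV_shift[of g' _ t l] deriv'[of "t + l"]
      by (simp_all add: add.commute[of l])
    show "((\<lambda>t. g (l + t) / t) has_real_derivative g' (l + t) / t - g (l + t) / t\<^sup>2) (at t)"
      by (rule DERIV_cong[OF DERIV_divide[OF shift(1) DERIV_ident t]])
        (use t in \<open>simp add: field_simps power2_eq_square\<close>)
    show "isCont (\<lambda>t. g' (l + t) / t - g (l + t) / t\<^sup>2) t"
      using t by (intro isCont_diff isCont_divide isCont_power continuous_ident shift[THEN DERIV_isCont]) auto
  next
    show "integrable lborel (\<lambda>t. g' (l + t) / t - g (l + t) / t\<^sup>2)"
      using integrable_double_zero by auto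
    have **: "\<bar>g (l + t) / t\<bar> \<le> C * \<bar>t\<bar>" for t
      using double_zero_bounds(2)[of t] C_nonneg
      by (cases "t = 0") (auto simp: abs_divide pos_divide_le_eq power2_eq_square mult_ac)
    have "((\<lambda>t. C * \<bar>t\<bar>) \<longlongrightarrow> 0) (at 0)"
      by (intro tendsto_mult_right_zero tendsto_rabs_zero tendsto_ident_at)
    then show "((\<lambda>t. g (l + t) / t) \<longlongrightarrow> 0) (at 0)"
      by (rule Lim_null_comparison[where g = "\<lambda>t. C * \<bar>t\<bar>", rotated]) (use ** in simp)
    have "\<bar>g x\<bar> \<le> C" for x
      using bound[of x] C_nonneg divide_left_mono[of 1 "1 + x\<^sup>2" C] by (auto simp: add_pos_nonneg)
    then have *: "\<bar>g (l + t) / t\<bar> \<le> C / \<bar>t\<bar>" for t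
      by (auto simp: abs_divide intro!: divide_right_mono)
    \<comment> \<open>A filter below \<open>at_infinity\<close> treats both ends of the line at
      once.\<close>
    have "filterlim (\<lambda>t::real. \<bar>t\<bar>) at_top F" if "F \<le> at_infinity" for F
      using filterlim_mono[OF filterlim_norm_at_top order_refl that] by (simp only: real_norm_def[abs_def])
    then have "((\<lambda>t. C / \<bar>t\<bar>) \<longlongrightarrow> 0) F" if "F \<le> at_infinity" for F
      using that by (intro real_tendsto_divide_at_top[OF tendsto_const])
    then have "((\<lambda>t. g (l + t) / t) \<longlongrightarrow> 0) F" if "F \<le> at_infinity" for F
      by (rule Lim_null_comparison[where g = "\<lambda>t. C / \<bar>t\<bar>", rotated]) (use * that in simp_all)
    then show "((\<lambda>t. g (l + t) / t) \<longlongrightarrow> 0) at_top" "((\<lambda>t. g (l + t) / t) \<longlongrightarrow> 0) at_bot"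
      using at_top_le_at_infinity at_bot_le_at_infinity by blast+
  qed
  then show ?thesis using integrable_double_zero by simp
qed

text \<open>At a double zero the two halves of the quotient are separately integrable, and
  reflection makes their integrals equal. The derivative of the transform thereby becomes the
  squared norm of \<open>phi\<close>.\<close>

lemma integral_sym_quot_double_zero:
  "(LINT t|lborel. sym_quot g' l t) / 2 = (LINT x|lborel. g x / (x - l)\<^sup>2)"
proof -
  let ?v = "\<lambda>t. g' (l + t) / t"
  have "sym_quot g' l = (\<lambda>t. ?v t + ?v (- t))"
    by (auto simp: sym_quot_def diff_divide_distrib)
  then have "(LINT t|lborel. sym_quot g' l t) = (LINT t|lborel. ?v t) + (LINT t|lborel. ?v (- t))"
    using integrable_double_zero(1) lborel_integrable_real_affine[OF integrable_double_zero(1), of "-1" 0]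
    by (simp del: add_uminus_conv_diff)
  also have "(LINT t|lborel. ?v (- t)) = (LINT t|lborel. ?v t)"
    using lborel_integral_real_affine[of "-1" ?v 0] by simp
  finally have "(LINT t|lborel. sym_quot g' l t) / 2 = (LINT t|lborel. g (l + t) / t\<^sup>2)"
    by (simp add: integral_by_parts_double_zero)
  also have "\<dots> = (LINT x|lborel. g x / (x - l)\<^sup>2)"
    using lborel_integral_real_affine[of 1 "\<lambda>x. g x / (x - l)\<^sup>2" l] by simp
  finally show ?thesis .
qed

lemma integrable_quotient_double_zero: "integrable lborel (\<lambda>x. g x / (x - l)\<^sup>2)"
  using integrable_double_zero(2)
    lborel_integrable_real_affine_iff[of 1 "\<lambda>x. g x / (x - l)\<^sup>2" l] by simp

end

end

section \<open>Schwartz functions\<close>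

text \<open>Adding the seminorms with weights 1 and x^2 gives the decay; the maximum over orders 0,
  1, 2 is a common constant.\<close>

lemma schwartz_derivatives:
  assumes "schwartz u"
  obtains u' u'' :: "real \<Rightarrow> complex" and K :: real where
    "\<And>x. (u has_vector_derivative u' x) (at x)" "\<And>x. (u' has_vector_derivative u'' x) (at x)"
    "\<And>x. cmod (u x) \<le> K / (1 + x\<^sup>2)" "\<And>x. cmod (u' x) \<le> K / (1 + x\<^sup>2)"
    "\<And>x. cmod (u'' x) \<le> K / (1 + x\<^sup>2)"
proof -
  define D where "D n = ((\<lambda>g x. vector_derivative g (at x)) ^^ n) u" for n :: nat
  have diff: "D n differentiable (at x)" and bdd: "bounded (range (\<lambda>x. x ^ k *\<^sub>R D n x))" for n k x
    using assms unfolding schwartz_def Let_def D_def by auto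
  have deriv: "(D n has_vector_derivative D (Suc n) x) (at x)" for n x
    using diff[of n x] by (simp add: vector_derivative_works D_def)
  have "\<exists>K. \<forall>x. cmod (D n x) \<le> K / (1 + x\<^sup>2)" for n
  proof -
    obtain A B where "cmod (D n x) \<le> A" "x\<^sup>2 * cmod (D n x) \<le> B" for x
      using bdd[of 0 n] bdd[of 2 n] by (auto simp: bounded_iff)
    then have "cmod (D n x) * (1 + x\<^sup>2) \<le> A + B" for x
      using add_mono[of "cmod (D n x)" A "x\<^sup>2 * cmod (D n x)" B] by (simp add: algebra_simps)
    then show ?thesis
      by (intro exI[of _ "A + B"]) (simp add: pos_le_divide_eq add_pos_nonneg)
  qed
  then obtain K where K: "\<And>n x. cmod (D n x) \<le> K n / (1 + x\<^sup>2)"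
    by metis
  define M where "M = max (K 0) (max (K 1) (K 2))"
  have M: "cmod (D n x) \<le> M / (1 + x\<^sup>2)" if "n \<in> {0, 1, 2}" for n x
  proof (rule order_trans[OF K])
    show "K n / (1 + x\<^sup>2) \<le> M / (1 + x\<^sup>2)"
      using that by (intro divide_right_mono) (auto simp: M_def)
  qed
  have D0: "D 0 = u" by (simp add: D_def)
  show ?thesis
  proof (rule that)
    show "(u has_vector_derivative D 1 x) (at x)" for x
      using deriv[of 0 x] by (simp add: D0)
    show "(D 1 has_vector_derivative D 2 x) (at x)" for x
      using deriv[of 1 x] by (simp add: numeral_2_eq_2)
    show "cmod (u x) \<le> M / (1 + x\<^sup>2)" for x
      using M[of 0 x] by (simp add: D0)
    show "cmod (D 1 x) \<le> M / (1 + x\<^sup>2)" "cmod (D 2 x) \<le> M / (1 + x\<^sup>2)" for x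
      by (rule M, simp)+
  qed
qed

text \<open>The squared modulus is the real inner product of \<open>u\<close> with itself, so the
  product rule applies. The first derivative is kept explicit to show that it vanishes wherever
  \<open>u\<close> does.\<close>

lemma schwartz_square_decaying_C2:
  assumes "schwartz u"
  obtains u' g'' C where "decaying_C2 (\<lambda>x. (cmod (u x))\<^sup>2) (\<lambda>x. 2 * (u x \<bullet> u' x)) g'' C"
proof -
  obtain u' u'' K where
    deriv: "\<And>x. (u has_vector_derivative u' x) (at x)" "\<And>x. (u' has_vector_derivative u'' x) (at x)"
    and K: "\<And>x. cmod (u x) \<le> K / (1 + x\<^sup>2)" "\<And>x. cmod (u' x) \<le> K / (1 + x\<^sup>2)"
      "\<And>x. cmod (u'' x) \<le> K / (1 + x\<^sup>2)"
    using schwartz_derivatives[OF assms] by blast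
  have prod: "\<bar>v \<bullet> w\<bar> \<le> K\<^sup>2 / (1 + x\<^sup>2)"
    if "cmod v \<le> K / (1 + x\<^sup>2)" "cmod w \<le> K / (1 + x\<^sup>2)" for v w and x :: real
  proof -
    have 1: "1 \<le> 1 + x\<^sup>2" by simp
    have "\<bar>v \<bullet> w\<bar> \<le> cmod v * cmod w" by (rule Cauchy_Schwarz_ineq2)
    also have "\<dots> \<le> (K / (1 + x\<^sup>2)) * (K / (1 + x\<^sup>2))"
      by (rule mult_mono) (use that order_trans[OF norm_ge_zero that(1)] in auto)
    also have "\<dots> = K\<^sup>2 / (1 + x\<^sup>2) / (1 + x\<^sup>2)" by (simp add: power2_eq_square)
    also have "\<dots> \<le> K\<^sup>2 / (1 + x\<^sup>2) / 1" using 1 by (intro divide_left_mono) (auto intro: add_pos_nonneg)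
    finally show ?thesis by simp
  qed
  have inner: "((\<lambda>x. v x \<bullet> w x) has_real_derivative v x \<bullet> w' + v' \<bullet> w x) (at x)"
    if "(v has_vector_derivative v') (at x)" "(w has_vector_derivative w') (at x)"
    for v w :: "real \<Rightarrow> complex" and v' w' x
    unfolding has_real_derivative_iff_has_vector_derivative
    by (rule bounded_bilinear.has_vector_derivative[OF bounded_bilinear_inner that])
  \<comment> \<open>The factor 4 comes from the second derivative: two inner products, each with
    coefficient 2 and bounded by \<open>K\<^sup>2 / (1 + x\<^sup>2)\<close>.\<close>
  have "decaying_C2 (\<lambda>x. (cmod (u x))\<^sup>2) (\<lambda>x. 2 * (u x \<bullet> u' x))
      (\<lambda>x. 2 * (u x \<bullet> u'' x + u' x \<bullet> u' x)) (4 * K\<^sup>2)"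
  proof
    fix x :: real
    show "((\<lambda>x. (cmod (u x))\<^sup>2) has_real_derivative 2 * (u x \<bullet> u' x)) (at x)"
      using inner[OF deriv(1) deriv(1)] by (simp add: power2_norm_eq_inner inner_commute)
    show "((\<lambda>x. 2 * (u x \<bullet> u' x)) has_real_derivative 2 * (u x \<bullet> u'' x + u' x \<bullet> u' x)) (at x)"
      by (rule DERIV_cmult[OF inner[OF deriv(1) deriv(2)]])
    have "\<bar>(cmod (u x))\<^sup>2\<bar> \<le> K\<^sup>2 / (1 + x\<^sup>2)" "\<bar>u x \<bullet> u' x\<bar> \<le> K\<^sup>2 / (1 + x\<^sup>2)"
      "\<bar>u x \<bullet> u'' x\<bar> \<le> K\<^sup>2 / (1 + x\<^sup>2)" "\<bar>u' x \<bullet> u' x\<bar> \<le> K\<^sup>2 / (1 + x\<^sup>2)"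
      using prod[OF K(1) K(1), of x] prod[OF K(1) K(2), of x] prod[OF K(1) K(3), of x]
        prod[OF K(2) K(2), of x]
      by (simp_all add: power2_norm_eq_inner)
    moreover have "\<bar>2 * (u x \<bullet> u'' x + u' x \<bullet> u' x)\<bar> \<le> 2 * \<bar>u x \<bullet> u'' x\<bar> + 2 * \<bar>u' x \<bullet> u' x\<bar>"
      "\<bar>2 * (u x \<bullet> u' x)\<bar> = 2 * \<bar>u x \<bullet> u' x\<bar>"
      using abs_triangle_ineq[of "u x \<bullet> u'' x" "u' x \<bullet> u' x"]
      by (simp_all add: abs_mult)
    moreover have "4 * K\<^sup>2 / (1 + x\<^sup>2) = 4 * (K\<^sup>2 / (1 + x\<^sup>2))" "0 \<le> K\<^sup>2 / (1 + x\<^sup>2)" by simp_all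
    ultimately show "\<bar>(cmod (u x))\<^sup>2\<bar> \<le> 4 * K\<^sup>2 / (1 + x\<^sup>2)"
      "\<bar>2 * (u x \<bullet> u' x)\<bar> \<le> 4 * K\<^sup>2 / (1 + x\<^sup>2)"
      "\<bar>2 * (u x \<bullet> u'' x + u' x \<bullet> u' x)\<bar> \<le> 4 * K\<^sup>2 / (1 + x\<^sup>2)"
      by linarith+
  qed
  then show ?thesis by (rule that)
qed

text \<open>The two integrands agree off the null set {l}. If the integral vanished,
  \<open>g\<close> would vanish almost everywhere, contradicting the nonzero norm of
  \<open>u\<close>.\<close>

lemma (in decaying_C2) l2_norm_phi:
  assumes g: "g = (\<lambda>x. (cmod (u x))\<^sup>2)" and zero: "u l = 0" "g' l = 0"
    and u_nonzero: "l2_norm u \<noteq> 0"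
  shows "(l2_norm (phi u l))\<^sup>2 = (LINT x|lborel. g x / (x - l)\<^sup>2)" "0 < (l2_norm (phi u l))\<^sup>2"
proof -
  have gl: "g l = 0" using g zero by simp
  define k where "k = (cmod (phi u l l))\<^sup>2"
  have eq: "(cmod (phi u l x))\<^sup>2 = (if x = l then k else g x / (x - l)\<^sup>2)" for x
    by (simp add: k_def phi_def g norm_divide power_divide del: of_real_diff)
  have "(LINT x|lborel. (cmod (phi u l x))\<^sup>2) = (LINT x|lborel. g x / (x - l)\<^sup>2)"
    unfolding eq
  proof (rule integral_cong_AE)
    show "AE x in lborel. (if x = l then k else g x / (x - l)\<^sup>2) = g x / (x - l)\<^sup>2"
      using AE_lborel_singleton[of l] by eventually_elim simp
  qed simp_all
  moreover have nonneg: "0 \<le> (LINT x|lborel. g x / (x - l)\<^sup>2)"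
    by (rule Bochner_Integration.integral_nonneg) (simp add: g)
  ultimately show *: "(l2_norm (phi u l))\<^sup>2 = (LINT x|lborel. g x / (x - l)\<^sup>2)"
    by (simp add: l2_norm_def)
  have "(LINT x|lborel. g x / (x - l)\<^sup>2) \<noteq> 0"
  proof
    assume "(LINT x|lborel. g x / (x - l)\<^sup>2) = 0"
    then have "AE x in lborel. g x / (x - l)\<^sup>2 = 0"
      using integral_nonneg_eq_0_iff_AE[OF integrable_quotient_double_zero[OF gl zero(2)]] by (simp add: g)
    then have "AE x in lborel. g x = 0"
      by eventually_elim (use gl in auto)
    then have "(LINT x|lborel. g x) = 0"
      by (rule integral_eq_zero_AE)
    with u_nonzero show False by (simp add: l2_norm_def g)
  qed
  with nonneg * show "0 < (l2_norm (phi u l))\<^sup>2" by linarith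
qed


section \<open>The resonance limit\<close>

theorem theorem6p1:
  fixes \<alpha>\<^sub>0 l\<^sub>0 h :: real and u :: "real \<Rightarrow> complex"
    and J :: "real set" and lam :: "real \<Rightarrow> real"
    and S R :: "real \<Rightarrow> real \<Rightarrow> complex"
  assumes u_schwartz: "schwartz u"
    and u_norm: "l2_norm u = 1"
    and u_zero: "\<And>x. u x = 0 \<longleftrightarrow> x = l\<^sub>0"
    and resonance: "1 + \<alpha>\<^sub>0 * pv (\<lambda>x. (cmod (u x))\<^sup>2) l\<^sub>0 = 0"
    and J: "open J" "is_interval J" "\<alpha>\<^sub>0 \<in> J"
    and lam_C1: "lam C1_differentiable_on J"
    and lam_0: "lam \<alpha>\<^sub>0 = l\<^sub>0"
    and lam_F1: "\<And>\<alpha>. \<alpha> \<in> J \<Longrightarrow> F1 u \<alpha> (lam \<alpha>) = 0"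
    and S_scattering:
      "\<And>\<alpha>. \<alpha> \<noteq> \<alpha>\<^sub>0 \<Longrightarrow> scattering_is_mult_by (hamiltonian u \<alpha>) (hamiltonian u 0) (S \<alpha>)"
    and S_representative:
      "\<And>\<alpha> x. \<alpha> \<noteq> \<alpha>\<^sub>0 \<Longrightarrow>
         S \<alpha> x = 1 - 2 * of_real pi * \<i> * of_real \<alpha> * (of_real ((cmod (u x))\<^sup>2) / F u \<alpha> x)"
    and R: "\<And>\<alpha> x. \<alpha> \<noteq> \<alpha>\<^sub>0 \<Longrightarrow> R \<alpha> x = S \<alpha> x - 1"
  shows "((\<lambda>\<alpha>. R \<alpha> (lam_shift u l\<^sub>0 lam h \<alpha>)) \<longlongrightarrow> - (2 * \<i> / (of_real h + \<i>))) (at \<alpha>\<^sub>0) \<and>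
    ((\<lambda>\<alpha>. (cmod (R \<alpha> (lam_shift u l\<^sub>0 lam h \<alpha>)))\<^sup>2) \<longlongrightarrow> 4 / (h\<^sup>2 + 1)) (at \<alpha>\<^sub>0)"
proof -
  define g where "g = (\<lambda>x. (cmod (u x))\<^sup>2)"
  obtain u' g'' C where "decaying_C2 (\<lambda>x. (cmod (u x))\<^sup>2) (\<lambda>x. 2 * (u x \<bullet> u' x)) g'' C"
    using schwartz_square_decaying_C2[OF u_schwartz] .
  then interpret decaying_C2 g "\<lambda>x. 2 * (u x \<bullet> u' x)" g'' C
    unfolding g_def .
  define g' where "g' = (\<lambda>x. 2 * (u x \<bullet> u' x))"
  have u0: "u l\<^sub>0 = 0" using u_zero by blast
  have zero: "g l\<^sub>0 = 0" "g' l\<^sub>0 = 0" using u0 by (auto simp: g_def g'_def)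
  define c where "c = (l2_norm (phi u l\<^sub>0))\<^sup>2"
  \<comment> \<open>The squared norm in the denominator of \<open>kappa\<close> is the slope of the
    principal value transform at the resonance.\<close>
  have c: "c = (LINT t|lborel. sym_quot g' l\<^sub>0 t) / 2" and c_pos: "0 < c"
    using l2_norm_phi[OF g_def u0] zero u_norm integral_sym_quot_double_zero[of l\<^sub>0]
    by (simp_all add: c_def g'_def)
  define G where "G = pv g"
  have F1: "F1 u \<alpha> l = 1 + \<alpha> * G l" for \<alpha> l
    by (simp add: F1_def G_def g_def)
  have G0: "1 + \<alpha>\<^sub>0 * G l\<^sub>0 = 0" using resonance by (simp add: G_def g_def)
  then have \<alpha>0: "\<alpha>\<^sub>0 \<noteq> 0" by auto
  have lam_cont: "isCont lam \<alpha>\<^sub>0"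
    using C1_differentiable_imp_continuous_on[OF lam_C1] J continuous_on_eq_continuous_at by blast

  \<comment> \<open>The limit is taken along sequences, the form in which strict differentiability
    was proved.\<close>
  have main: "(\<lambda>n. R (X n) (lam_shift u l\<^sub>0 lam h (X n))) \<longlonglongrightarrow> - (2 * \<i> / (of_real h + \<i>))"
    if X: "\<And>n. X n \<noteq> \<alpha>\<^sub>0" "X \<longlonglongrightarrow> \<alpha>\<^sub>0" for X :: "nat \<Rightarrow> real"
  proof -
    define a where "a n = lam (X n)" for n
    define b where "b n = lam_shift u l\<^sub>0 lam h (X n)" for n
    have ba: "b n - a n = h * pi * g (a n) / c" for n
      by (simp add: a_def b_def lam_shift_def kappa_def g_def c_def)
    have a_lim: "a \<longlonglongrightarrow> l\<^sub>0"
      using isCont_tendsto_compose[OF lam_cont X(2)] by (simp add: a_def[abs_def] lam_0)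
    have "(\<lambda>n. h * pi * g (a n) / c) \<longlonglongrightarrow> h * pi * g l\<^sub>0 / c"
      by (intro tendsto_intros isCont_tendsto_compose[OF isCont a_lim]) (use c_pos in auto)
    then have ba_lim: "(\<lambda>n. b n - a n) \<longlonglongrightarrow> 0" by (simp add: ba zero)
    from tendsto_add[OF this a_lim] have b_lim: "b \<longlonglongrightarrow> l\<^sub>0" by simp
    have good: "\<forall>\<^sub>F n in sequentially. X n \<in> J \<and> X n \<noteq> 0"
      using topological_tendstoD[OF X(2) J(1,3)] tendsto_imp_eventually_ne[OF X(2) \<alpha>0]
      by eventually_elim simp
    have root: "1 + X n * G (a n) = 0" if "X n \<in> J" for n
      using lam_F1[OF that] by (simp add: F1 a_def)
    \<comment> \<open>A root of \<open>F1\<close> at the resonance point would force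
      \<open>X n = \<alpha>\<^sub>0\<close>, because 1 + x G(l0) = 0 determines x.\<close>
    have ga: "g (a n) \<noteq> 0" if "X n \<in> J" for n
    proof
      assume "g (a n) = 0"
      then have "a n = l\<^sub>0" using u_zero by (simp add: g_def)
      then have "1 + X n * G l\<^sub>0 = 0" using root[OF that] by simp
      with G0 have "X n * G l\<^sub>0 = \<alpha>\<^sub>0 * G l\<^sub>0" by linarith
      moreover have "G l\<^sub>0 \<noteq> 0" using G0 by auto
      ultimately show False using X(1)[of n] by simp
    qed

    define r where "r n = g (b n) / g (a n)" for n
    define q where "q n = (G (b n) - G (a n)) / (pi * g (a n))" for n
    have q_lim: "q \<longlonglongrightarrow> h"
    \<comment> \<open>For \<open>h = 0\<close> the points \<open>a n\<close> and \<open>b n\<close>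
      coincide, so there is no difference quotient to apply strict differentiability to.\<close>
    proof (cases "h = 0")
      case True
      then have "q n = 0" for n using ba[of n] by (simp add: q_def)
      then have "q = (\<lambda>n. 0)" by auto
      then show ?thesis using True by simp
    next
      case False
      have ne: "\<forall>\<^sub>F n in sequentially. a n \<noteq> b n"
        using good
      proof eventually_elim
        case (elim n)
        then have "b n - a n \<noteq> 0" using False ga[of n] c_pos unfolding ba by simp
        then show ?case by simp
      qed
      have "(\<lambda>n. (G (b n) - G (a n)) / (b n - a n)) \<longlonglongrightarrow> c"
        using pv_strict_derivative[OF a_lim b_lim ne] by (simp add: c G_def g'_def)
      then have "(\<lambda>n. (G (b n) - G (a n)) / (b n - a n) * (h / c)) \<longlonglongrightarrow> c * (h / c)"
        by (intro tendsto_intros)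
      \<comment> \<open>The factor \<open>h / c\<close> exchanges the denominator
        \<open>b n - a n\<close> for \<open>pi * g (a n)\<close>. If \<open>g (a n) = 0\<close>,
        both sides are 0 by division by zero.\<close>
      moreover have "(G (b n) - G (a n)) / (b n - a n) * (h / c) = q n" for n
        using False c_pos unfolding ba q_def by (cases "g (a n) = 0") (simp_all add: field_simps)
      ultimately show ?thesis using c_pos by simp
    qed
    \<comment> \<open>The step \<open>b n - a n\<close> is proportional to \<open>g (a n)\<close>,
      which cancels in the relative change of \<open>g\<close> and leaves a multiple of
      \<open>g'\<close> at an intermediate point. That value tends to
      \<open>g' l\<^sub>0 = 0\<close>.\<close>
    have r_lim: "r \<longlonglongrightarrow> 1"
    proof -
      have "\<exists>\<xi>. \<bar>\<xi> - a n\<bar> \<le> \<bar>b n - a n\<bar> \<and> g (b n) - g (a n) = (b n - a n) * g' \<xi>" for n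
        unfolding g'_def by (rule mean_value_between[OF deriv]) blast
      then obtain \<xi> where \<xi>: "\<And>n. \<bar>\<xi> n - a n\<bar> \<le> \<bar>b n - a n\<bar>"
          "\<And>n. g (b n) - g (a n) = (b n - a n) * g' (\<xi> n)"
        by metis
      have "(\<lambda>n. \<xi> n - a n) \<longlonglongrightarrow> 0"
        by (rule Lim_null_comparison[OF _ tendsto_rabs_zero[OF ba_lim]]) (use \<xi>(1) in simp)
      from tendsto_add[OF this a_lim] have "\<xi> \<longlonglongrightarrow> l\<^sub>0" by simp
      then have "(\<lambda>n. g' (\<xi> n)) \<longlonglongrightarrow> g' l\<^sub>0"
        unfolding g'_def by (rule isCont_tendsto_compose[OF isCont'])
      then have "(\<lambda>n. 1 + h * pi / c * g' (\<xi> n)) \<longlonglongrightarrow> 1 + h * pi / c * g' l\<^sub>0"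
        by (intro tendsto_intros)
      then have "(\<lambda>n. 1 + h * pi / c * g' (\<xi> n)) \<longlonglongrightarrow> 1" by (simp add: zero)
      moreover have "\<forall>\<^sub>F n in sequentially. 1 + h * pi / c * g' (\<xi> n) = r n"
        using good
      proof eventually_elim
        case (elim n)
        then have "g (a n) \<noteq> 0" using ga by simp
        then have "r n = 1 + (g (b n) - g (a n)) / g (a n)"
          by (simp add: r_def diff_divide_distrib)
        also have "\<dots> = 1 + h * pi / c * g' (\<xi> n)"
          unfolding \<xi>(2) ba using \<open>g (a n) \<noteq> 0\<close> by simp
        finally show ?case by simp
      qed
      ultimately show ?thesis by (rule Lim_transform_eventually)
    qed

    \<comment> \<open>The limiting denominator has imaginary part 1; \<open>of_real 1\<close> is
      written out to match the limit of \<open>r\<close>.\<close>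
    have "complex_of_real h + \<i> * of_real 1 \<noteq> 0" by (simp add: complex_eq_iff)
    then have "(\<lambda>n. - (2 * \<i> * of_real (r n) / (of_real (q n) + \<i> * of_real (r n))))
        \<longlonglongrightarrow> - (2 * \<i> * of_real 1 / (of_real h + \<i> * of_real 1))"
      by (intro tendsto_intros q_lim r_lim)
    then have lim: "(\<lambda>n. - (2 * \<i> * of_real (r n) / (of_real (q n) + \<i> * of_real (r n))))
        \<longlonglongrightarrow> - (2 * \<i> / (of_real h + \<i>))"
      by simp
    have "\<forall>\<^sub>F n in sequentially.
        - (2 * \<i> * of_real (r n) / (of_real (q n) + \<i> * of_real (r n))) = R (X n) (b n)"
      using good
    proof eventually_elim
      case (elim n)
      \<comment> \<open>A common factor of the real and imaginary parts of \<open>F\<close> at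
        \<open>b n\<close>: subtracting the root equation at \<open>a n\<close> makes
        \<open>F1\<close> there a multiple of \<open>G (b n) - G (a n)\<close>. The factor cancels
        from the stationary formula.\<close>
      define k where "k = X n * pi * g (a n)"
      have k: "k \<noteq> 0" using elim ga[of n] by (simp add: k_def)
      have "1 + X n * G (b n) = X n * (G (b n) - G (a n))"
        using root[of n] elim by (simp add: algebra_simps)
      also have "\<dots> = k * q n" using ga[of n] elim by (simp add: k_def q_def)
      finally have "F1 u (X n) (b n) = k * q n" by (simp add: F1)
      moreover have num: "X n * pi * g (b n) = k * r n"
        using ga[of n] elim by (simp add: k_def r_def)
      ultimately have F: "F u (X n) (b n) = of_real k * (of_real (q n) + \<i> * of_real (r n))"
        by (simp add: F_def F2_def g_def algebra_simps)
      have "R (X n) (b n) = - (2 * \<i> * of_real (X n * pi * g (b n)) / F u (X n) (b n))"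
        using X(1)[of n] by (simp add: R S_representative g_def)
      also have "\<dots> = - (2 * \<i> * of_real (r n) / (of_real (q n) + \<i> * of_real (r n)))"
        unfolding num F using k by simp
      finally show ?case by simp
    qed
    from Lim_transform_eventually[OF lim this] show ?thesis by (simp add: b_def)
  qed
  have lim: "((\<lambda>\<alpha>. R \<alpha> (lam_shift u l\<^sub>0 lam h \<alpha>)) \<longlongrightarrow> - (2 * \<i> / (of_real h + \<i>))) (at \<alpha>\<^sub>0)"
    unfolding tendsto_at_iff_sequentially comp_def using main by auto
  moreover have "(cmod (- (2 * \<i> / (of_real h + \<i>))))\<^sup>2 = 4 / (h\<^sup>2 + 1)"
    by (simp add: norm_divide norm_mult power_divide cmod_power2)
  ultimately show ?thesis
    using tendsto_power[OF tendsto_norm[OF lim], of 2] by simp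
qed

end
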